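(* For minimizing the total weighted completion time on a single machine with online out-forest precedence constraints and adaptive weight predictions, there is a non-clairvoyant algorithm with a competitive ratio of at most \[O(1)\cdot\min\left\{\max_{v\in J}\frac{\hat W_v}{w(S(v))}\cdot\max_{v\in J}\frac{w(S(v))}{\hat W_v},\ \omega\right\}.\]
   Context: Problem (non-clairvoyant single-machine scheduling with online precedence constraints): jobs $J$ with processing requirements $p_j\ge0$ and weights $w_j\ge0$; precedence DAG $G=(J,E)$ which is an out-forest (every job has at most one incoming edge). A job can be processed only after all its predecessors are completed, and is revealed (with its weight but not its processing requirement) only then; $G$ is unknown to the algorithm. Time is discrete; rates $R_j^t\ge0$, $\sum_jR_j^t\le1$; $C_j$ is the first $t$ with $\sum_{t'\le t}R_j^{t'}\ge p_j$. Objective: minimize $\sum_jw_jC_j$ versus the offline optimum. The width $\omega$ is the maximum size of an antichain of $G$. For a job $v$, $S(v)$ is $v$ together with all its successors and $w(S(v))=\sum_{u\in S(v)}w_u$. Adaptive weight predictions: whenever a job $v$ becomes visible, the algorithm receives a (possibly erroneous) prediction $\hat W_v$ of $w(S(v))$.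
   Formalization: Slots are numbered from 1; a job with p_j = 0 completes in the first slot that begins with all its predecessors completed (the literal formula would let it finish before them, and the claim would fail); predictions are nonnegative, with a/0 = ∞ for a > 0, 0/0 = 1 and 0·∞ = ∞ in the error. *)

theory Defs
  imports Complex_Main "HOL-Library.Extended_Nonnegative_Real"
begin

text \<open>Jobs carry natural numbers as identifiers. The field \<open>forecast\<close> is the prediction of the
  total weight of a job together with its successors.\<close>

record inst =
  jobs :: "nat set"
  edges :: "(nat \<times> nat) set"
  proc :: "nat \<Rightarrow> real"
  weight :: "nat \<Rightarrow> real"
  forecast :: "nat \<Rightarrow> real"

definition out_forest_inst :: "inst \<Rightarrow> bool" where
  "out_forest_inst I \<longleftrightarrow>
     finite (jobs I) \<and>
     edges I \<subseteq> jobs I \<times> jobs I \<and>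
     acyclic (edges I) \<and>
     (\<forall>i i' j. (i, j) \<in> edges I \<and> (i', j) \<in> edges I \<longrightarrow> i = i') \<and>
     (\<forall>j \<in> jobs I. 0 \<le> proc I j \<and> 0 \<le> weight I j \<and> 0 \<le> forecast I j)"

definition preds :: "inst \<Rightarrow> nat \<Rightarrow> nat set" where
  "preds I j = {i. (i, j) \<in> (edges I)\<^sup>+}"

definition succs_refl :: "inst \<Rightarrow> nat \<Rightarrow> nat set" where
  "succs_refl I v = insert v {u. (v, u) \<in> (edges I)\<^sup>+}"

definition succ_weight :: "inst \<Rightarrow> nat \<Rightarrow> real" where
  "succ_weight I v = (\<Sum>u \<in> succs_refl I v. weight I u)"

definition antichain_of :: "inst \<Rightarrow> nat set \<Rightarrow> bool" where
  "antichain_of I A \<longleftrightarrow> A \<subseteq> jobs I \<and> (\<forall>u\<in>A. \<forall>v\<in>A. (u, v) \<notin> (edges I)\<^sup>+)"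

definition width :: "inst \<Rightarrow> nat" where
  "width I = Max (card ` {A. antichain_of I A})"


text \<open>Time slots are numbered 1, 2, 3, \<dots>; slot \<open>t\<close> is the interval from time \<open>t - 1\<close> to time \<open>t\<close>,
  and \<open>R t j\<close> is the rate of job \<open>j\<close> in slot \<open>t\<close> (the value at \<open>t = 0\<close> is irrelevant).

  \<open>finished I R t\<close> is the set of jobs completed by the end of slot \<open>t\<close>. A job completes in the
  first slot by the end of which it has received its processing requirement, among the slots that
  begin with all its predecessors completed. In a feasible schedule the latter restriction only
  matters for jobs with processing requirement 0 (see \<open>completion_time_eq\<close> below); without it such
  a job would complete before its predecessors.\<close>

type_synonym schedule = "nat \<Rightarrow> nat \<Rightarrow> real"

primrec finished :: "inst \<Rightarrow> schedule \<Rightarrow> nat \<Rightarrow> nat set" where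
  "finished I R 0 = {}"
| "finished I R (Suc t) = finished I R t \<union>
     {j \<in> jobs I. preds I j \<subseteq> finished I R t \<and> proc I j \<le> (\<Sum>s=1..Suc t. R s j)}"

definition completion_time :: "inst \<Rightarrow> schedule \<Rightarrow> nat \<Rightarrow> nat" where
  "completion_time I R j = (LEAST t. j \<in> finished I R t)"

text \<open>\<open>visible I R t\<close> and \<open>front I R t\<close> describe the situation at time \<open>t\<close>, i.e. at the beginning
  of slot \<open>t + 1\<close>.\<close>

definition visible :: "inst \<Rightarrow> schedule \<Rightarrow> nat \<Rightarrow> nat set" where
  "visible I R t = {j \<in> jobs I. preds I j \<subseteq> finished I R t}"

definition front :: "inst \<Rightarrow> schedule \<Rightarrow> nat \<Rightarrow> nat set" where
  "front I R t = visible I R t - finished I R t"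

definition feasible :: "inst \<Rightarrow> schedule \<Rightarrow> bool" where
  "feasible I R \<longleftrightarrow>
     (\<forall>t. (\<forall>j. 0 \<le> R (Suc t) j) \<and>
          (\<Sum>j \<in> jobs I. R (Suc t) j) \<le> 1 \<and>
          (\<forall>j. R (Suc t) j \<noteq> 0 \<longrightarrow> j \<in> visible I R t)) \<and>
     (\<forall>j \<in> jobs I. \<exists>t. j \<in> finished I R t)"

definition cost :: "inst \<Rightarrow> schedule \<Rightarrow> real" where
  "cost I R = (\<Sum>j \<in> jobs I. weight I j * real (completion_time I R j))"

definition opt :: "inst \<Rightarrow> real" where
  "opt I = (INF R \<in> {R. feasible I R}. cost I R)"


text \<open>At the beginning of every slot a non-clairvoyant algorithm observes which jobs are visible and
  unfinished, with their weights and predictions, and nothing else about the instance. It chooses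
  the rates of the slot as a function of all observations made so far. As every job is in the front
  for at least one slot, the observations determine which jobs have been revealed and completed,
  and when.\<close>

type_synonym observation = "nat \<rightharpoonup> real \<times> real"

type_synonym algorithm = "observation list \<Rightarrow> nat \<Rightarrow> real"

definition observe :: "inst \<Rightarrow> schedule \<Rightarrow> nat \<Rightarrow> observation" where
  "observe I R t = (\<lambda>j. if j \<in> front I R t then Some (weight I j, forecast I j) else None)"

definition history :: "inst \<Rightarrow> schedule \<Rightarrow> nat \<Rightarrow> observation list" where
  "history I R t = map (observe I R) [0..<Suc t]"

primrec run_upto :: "algorithm \<Rightarrow> inst \<Rightarrow> nat \<Rightarrow> schedule" where
  "run_upto A I 0 = (\<lambda>_ _. 0)"
| "run_upto A I (Suc t) = (run_upto A I t) (Suc t := A (history I (run_upto A I t) t))"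

definition run :: "algorithm \<Rightarrow> inst \<Rightarrow> schedule" where
  "run A I t = run_upto A I t t"

definition competitive :: "algorithm \<Rightarrow> (inst \<Rightarrow> ennreal) \<Rightarrow> bool" where
  "competitive A \<rho> \<longleftrightarrow> (\<forall>I. out_forest_inst I \<longrightarrow>
     feasible I (run A I) \<and> ennreal (cost I (run A I)) \<le> \<rho> I * ennreal (opt I))"


text \<open>Quotients of nonnegative reals: \<open>a / 0\<close> is infinite for \<open>a > 0\<close>, and \<open>0 / 0\<close>, which only arises
  for a correct prediction of the value 0, counts as 1.\<close>

definition quot :: "real \<Rightarrow> real \<Rightarrow> ennreal" where
  "quot a b = (if a = 0 \<and> b = 0 then 1 else ennreal a / ennreal b)"

definition max_overestimate :: "inst \<Rightarrow> ennreal" where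
  "max_overestimate I = (SUP v \<in> jobs I. quot (forecast I v) (succ_weight I v))"

definition max_underestimate :: "inst \<Rightarrow> ennreal" where
  "max_underestimate I = (SUP v \<in> jobs I. quot (succ_weight I v) (forecast I v))"

text \<open>On type \<^typ>\<open>ennreal\<close> the product of 0 and infinity is 0; here it has to be infinite, because
  it arises when all predictions are 0 and all predicted values are positive.\<close>

definition prediction_error :: "inst \<Rightarrow> ennreal" where
  "prediction_error I =
     (if max_overestimate I = top \<or> max_underestimate I = top then top
      else max_overestimate I * max_underestimate I)"


lemma finished_cong:
  "(\<And>s. 1 \<le> s \<Longrightarrow> s \<le> t \<Longrightarrow> R s = R' s) \<Longrightarrow> finished I R t = finished I R' t"
proof (induction t)
  case (Suc t)
  have "(\<Sum>s=1..Suc t. R s j) = (\<Sum>s=1..Suc t. R' s j)" for j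
    by (rule sum.cong) (use Suc.prems in auto)
  moreover have "finished I R t = finished I R' t"
    using Suc by simp
  ultimately show ?case by simp
qed simp

lemma history_cong:
  assumes "\<And>s. 1 \<le> s \<Longrightarrow> s \<le> t \<Longrightarrow> R s = R' s"
  shows "history I R t = history I R' t"
proof -
  have "finished I R s = finished I R' s" if "s \<le> t" for s
    by (rule finished_cong) (use assms that in auto)
  then show ?thesis
    by (auto simp: history_def observe_def front_def visible_def)
qed

lemma run_upto_eq: "s \<le> t \<Longrightarrow> run_upto A I t s = run A I s"
  by (induction t) (auto simp: run_def le_Suc_eq)

lemma run_Suc: "run A I (Suc t) = A (history I (run A I) t)"
proof -
  have "history I (run_upto A I t) t = history I (run A I) t"
    by (rule history_cong) (simp add: run_upto_eq)
  then show ?thesis by (simp add: run_def)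
qed

lemma finished_imp_processed:
  assumes "feasible I R" "j \<in> finished I R t"
  shows "proc I j \<le> (\<Sum>s=1..t. R s j)"
  using assms(2)
proof (induction t)
  case (Suc t)
  have "0 \<le> R (Suc t) j" using assms(1) by (simp add: feasible_def)
  with Suc show ?case by fastforce
qed simp

lemma processed_imp_finished:
  assumes "feasible I R" "j \<in> jobs I" "0 < proc I j" "proc I j \<le> (\<Sum>s=1..t. R s j)"
  shows "j \<in> finished I R t"
  using assms(4)
proof (induction t)
  case 0
  with assms(3) show ?case by simp
next
  case (Suc t)
  show ?case
  proof (cases "R (Suc t) j = 0")
    case True
    with Suc show ?thesis by simp
  next
    case False
    then have "j \<in> visible I R t" using assms(1) by (simp add: feasible_def)
    with Suc.prems assms(2) show ?thesis by (auto simp: visible_def)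
  qed
qed

lemma completion_time_eq:
  assumes "feasible I R" "j \<in> jobs I" "0 < proc I j"
  shows "completion_time I R j = (LEAST t. proc I j \<le> (\<Sum>s=1..t. R s j))"
  unfolding completion_time_def
  using finished_imp_processed[OF assms(1)] processed_imp_finished[OF assms] by metis

end

theory Submission
  imports Defs
begin

text \<open>The algorithm gives half of the machine to the front in proportion to the predictions and
  splits the other half evenly. The front is an antichain, so the even half delays every chain by a
  factor of order \<open>\<omega>\<close> only.

  For the other bound let \<open>W t\<close> and \<open>W' t\<close> be the weights unfinished at time \<open>t\<close> in the algorithm and
  in an arbitrary schedule, so that the costs are the sums of \<open>W\<close> and \<open>W'\<close>. In an out-forest the
  sets \<open>S v\<close>, \<open>v\<close> in the front, are disjoint, so \<open>v\<close> runs at rate at least \<open>w (S v) / (\<kappa> * W t)\<close>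
  with \<open>\<kappa>\<close> of the order of the prediction error. Let \<open>D\<close> be the set of jobs that the other
  schedule finishes by time \<open>T\<close>; its total processing requirement and the lengths of its chains are
  at most \<open>T\<close>. If \<open>t\<close> is a large multiple of \<open>\<kappa> * T\<close>, \<open>W\<close> loses at most a constant factor between \<open>t / 2\<close>
  and \<open>t\<close>, and at least half of \<open>W t\<close> is in \<open>D\<close>, then \<open>D\<close> is processed by more than \<open>T\<close> up to time
  \<open>t\<close>, a contradiction. Hence \<open>W t \<le> W (t / 2) / 4 + 2 * W' T\<close>, and summing over \<open>t\<close> gives the
  bound. The restriction to times after \<open>t / 2\<close> copes with the discrete time model: the work wasted
  in the last slot of a job can be bounded only relative to the weight that survives until \<open>t\<close>.\<close>

section \<open>Out-forests\<close>

text \<open>In an out-forest this is the path from the root to \<open>j\<close>. With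
  \<open>j\<close> included, the strict predecessors of a child are exactly the ancestors of its
  parent.\<close>

definition ancestors :: "inst \<Rightarrow> nat \<Rightarrow> nat set" where
  "ancestors I j = insert j (preds I j)"

lemma ancestors_iff: "i \<in> ancestors I j \<longleftrightarrow> (i, j) \<in> (edges I)\<^sup>*"
  by (auto simp: ancestors_def preds_def rtrancl_eq_or_trancl)

lemma succs_refl_iff: "j \<in> succs_refl I i \<longleftrightarrow> (i, j) \<in> (edges I)\<^sup>*"
  by (auto simp: succs_refl_def rtrancl_eq_or_trancl)

lemma out_forest_instD:
  assumes "out_forest_inst I"
  shows "finite (jobs I)" "edges I \<subseteq> jobs I \<times> jobs I" "acyclic (edges I)"
    "\<And>i i' j. (i, j) \<in> edges I \<Longrightarrow> (i', j) \<in> edges I \<Longrightarrow> i = i'"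
    "\<And>j. j \<in> jobs I \<Longrightarrow> 0 \<le> proc I j"
    "\<And>j. j \<in> jobs I \<Longrightarrow> 0 \<le> weight I j"
    "\<And>j. j \<in> jobs I \<Longrightarrow> 0 \<le> forecast I j"
  using assms unfolding out_forest_inst_def by blast+

lemma trancl_edges_subset:
  assumes "out_forest_inst I"
  shows "(edges I)\<^sup>+ \<subseteq> jobs I \<times> jobs I"
  using trancl_subset_Sigma out_forest_instD(2)[OF assms] by metis

lemma preds_subset: "out_forest_inst I \<Longrightarrow> preds I j \<subseteq> jobs I"
  using trancl_edges_subset by (fastforce simp: preds_def)

lemma succs_refl_subset: "out_forest_inst I \<Longrightarrow> j \<in> jobs I \<Longrightarrow> succs_refl I j \<subseteq> jobs I"
  using trancl_edges_subset by (fastforce simp: succs_refl_def)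

lemma finite_ancestors: "out_forest_inst I \<Longrightarrow> finite (ancestors I j)"
  by (simp add: ancestors_def finite_subset[OF preds_subset out_forest_instD(1)])

lemma finite_succs_refl: "out_forest_inst I \<Longrightarrow> j \<in> jobs I \<Longrightarrow> finite (succs_refl I j)"
  by (rule finite_subset[OF succs_refl_subset out_forest_instD(1)])

lemma not_in_preds: "out_forest_inst I \<Longrightarrow> j \<notin> preds I j"
  using out_forest_instD(3) by (auto simp: preds_def acyclic_def)

lemma succ_weight_nonneg: "out_forest_inst I \<Longrightarrow> j \<in> jobs I \<Longrightarrow> 0 \<le> succ_weight I j"
  unfolding succ_weight_def
  by (rule sum_nonneg) (rule out_forest_instD(6)[OF _ subsetD[OF succs_refl_subset]])

lemma preds_root_or_parent:
  assumes "out_forest_inst I"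
  obtains "preds I j = {}" | i where "(i, j) \<in> edges I" "preds I j = ancestors I i"
proof (cases "preds I j = {}")
  case False
  then obtain u where "(u, j) \<in> (edges I)\<^sup>+" by (auto simp: preds_def)
  then obtain i where i: "(i, j) \<in> edges I" by (meson tranclE)
  have "preds I j = ancestors I i"
  proof (intro set_eqI iffI)
    fix u assume "u \<in> preds I j"
    then obtain i' where "(u, i') \<in> (edges I)\<^sup>*" "(i', j) \<in> edges I"
      by (auto simp: preds_def dest: tranclD2)
    with i out_forest_instD(4)[OF assms] show "u \<in> ancestors I i"
      by (metis ancestors_iff)
  next
    fix u assume "u \<in> ancestors I i"
    with i show "u \<in> preds I j" by (auto simp: ancestors_iff preds_def)
  qed
  with i that show ?thesis by blast
qed (use that in blast)

text \<open>Induction down the tree; a finite acyclic relation is well-founded. The child case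
  carries \<open>preds I j = ancestors I i\<close>, so that facts about a path extend by a single
  job.\<close>

lemma forest_induct [consumes 1, case_names root child]:
  assumes "out_forest_inst I"
    and root: "\<And>j. preds I j = {} \<Longrightarrow> P j"
    and child: "\<And>i j. (i, j) \<in> edges I \<Longrightarrow> preds I j = ancestors I i \<Longrightarrow> P i \<Longrightarrow> P j"
  shows "P j"
proof -
  have "finite (edges I)"
    using out_forest_instD(1,2)[OF assms(1)] by (meson finite_SigmaI finite_subset)
  then have "wf (edges I)"
    using out_forest_instD(3)[OF assms(1)] by (rule finite_acyclic_wf)
  then show ?thesis
  proof (induction j)
    case (less j)
    then show ?case
      using preds_root_or_parent[OF assms(1), of j] root child by metis
  qed
qed

text \<open>Each job has at most one parent, so walking backwards from \<open>u\<close> is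
  deterministic and one of the two walks continues the other.\<close>

lemma common_successor_comparable:
  assumes "out_forest_inst I" "(i, u) \<in> (edges I)\<^sup>*" "(i', u) \<in> (edges I)\<^sup>*"
  shows "(i, i') \<in> (edges I)\<^sup>* \<or> (i', i) \<in> (edges I)\<^sup>*"
proof -
  have "single_valued ((edges I)\<inverse>)"
    using out_forest_instD(4)[OF assms(1)] by (auto simp: single_valued_def)
  from single_valued_confluent[OF this, of u i i'] assms(2,3) show ?thesis
    by (auto simp: rtrancl_converse)
qed

section \<open>Schedules\<close>

lemma finished_mono: "s \<le> t \<Longrightarrow> finished I R s \<subseteq> finished I R t"
  by (rule lift_Suc_mono_le[of "finished I R"]) auto

lemma finished_subset: "finished I R t \<subseteq> jobs I"
  by (induction t) auto

lemma preds_subset_finished: "j \<in> finished I R t \<Longrightarrow> preds I j \<subseteq> finished I R t"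
  by (induction t) auto

lemma ancestors_subset_finished: "j \<in> finished I R t \<Longrightarrow> ancestors I j \<subseteq> finished I R t"
  using preds_subset_finished by (fastforce simp: ancestors_def)

lemma visible_mono: "s \<le> t \<Longrightarrow> visible I R s \<subseteq> visible I R t"
  using finished_mono by (fastforce simp: visible_def)

lemma front_subset: "front I R t \<subseteq> jobs I"
  by (auto simp: front_def visible_def)

lemma finite_front: "out_forest_inst I \<Longrightarrow> finite (front I R t)"
  by (rule finite_subset[OF front_subset out_forest_instD(1)])

lemma front_antichain: "antichain_of I (front I R t)"
  by (auto simp: antichain_of_def front_def visible_def preds_def)

lemma card_front_le_width:
  assumes "out_forest_inst I"
  shows "card (front I R t) \<le> width I"
proof -
  have "finite {A. antichain_of I A}"
    by (rule finite_subset[of _ "Pow (jobs I)"])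
      (use out_forest_instD(1)[OF assms] in \<open>auto simp: antichain_of_def\<close>)
  then show ?thesis
    unfolding width_def using front_antichain by (intro Max_ge) auto
qed

text \<open>The first unfinished job on the path from the root to \<open>j\<close> has all its
  predecessors finished.\<close>

lemma front_ancestor_exists:
  assumes "out_forest_inst I" "j \<in> jobs I" "j \<notin> finished I R t"
  shows "\<exists>i \<in> ancestors I j. i \<in> front I R t"
  using assms
proof (induction j rule: forest_induct)
  case (root j)
  then show ?case by (auto simp: front_def visible_def ancestors_def)
next
  case (child i j)
  show ?case
  proof (cases "i \<in> finished I R t")
    case True
    then have "preds I j \<subseteq> finished I R t"
      using child ancestors_subset_finished by metis
    with child show ?thesis by (auto simp: front_def visible_def ancestors_def)
  next
    case False
    moreover have "i \<in> jobs I" using child out_forest_instD(2)[OF assms(1)] by blast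
    ultimately show ?thesis using child by (auto simp: ancestors_def)
  qed
qed

section \<open>Unfinished weight\<close>

definition pending_weight :: "inst \<Rightarrow> schedule \<Rightarrow> nat \<Rightarrow> real" where
  "pending_weight I R t = (\<Sum>j \<in> jobs I - finished I R t. weight I j)"

lemma pending_weight_nonneg: "out_forest_inst I \<Longrightarrow> 0 \<le> pending_weight I R t"
  unfolding pending_weight_def by (rule sum_nonneg) (use out_forest_instD(6) in auto)

lemma pending_weight_antimono:
  assumes "out_forest_inst I" "s \<le> t"
  shows "pending_weight I R t \<le> pending_weight I R s"
  unfolding pending_weight_def
  by (rule sum_mono2)
    (use finished_mono[OF assms(2)] out_forest_instD[OF assms(1)] in auto)

text \<open>Two front jobs with a common successor would be comparable, which the antichain property
  forbids. A successor of a front job is unfinished because finished sets are closed under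
  ancestors.\<close>

lemma sum_front_succ_weight_le:
  assumes "out_forest_inst I"
  shows "(\<Sum>i \<in> front I R t. succ_weight I i) \<le> pending_weight I R t"
proof -
  let ?F = "front I R t"
  have disjoint: "succs_refl I i \<inter> succs_refl I i' = {}" if "i \<in> ?F" "i' \<in> ?F" "i \<noteq> i'" for i i'
  proof (rule ccontr)
    assume "succs_refl I i \<inter> succs_refl I i' \<noteq> {}"
    then obtain u where "(i, u) \<in> (edges I)\<^sup>*" "(i', u) \<in> (edges I)\<^sup>*"
      by (auto simp: succs_refl_iff)
    from common_successor_comparable[OF assms this] that(3)
    have "(i, i') \<in> (edges I)\<^sup>+ \<or> (i', i) \<in> (edges I)\<^sup>+"
      by (auto simp: rtrancl_eq_or_trancl)
    with that front_antichain[of I R t] show False by (auto simp: antichain_of_def)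
  qed
  have "(\<Sum>i \<in> ?F. succ_weight I i) = (\<Sum>u \<in> (\<Union>i \<in> ?F. succs_refl I i). weight I u)"
    unfolding succ_weight_def
    by (rule sum.UNION_disjoint[symmetric])
      (use finite_front[OF assms] finite_succs_refl[OF assms] front_subset disjoint in blast)+
  also have "\<dots> \<le> pending_weight I R t"
    unfolding pending_weight_def
  proof (rule sum_mono2)
    show "(\<Union>i \<in> ?F. succs_refl I i) \<subseteq> jobs I - finished I R t"
    proof
      fix u assume "u \<in> (\<Union>i \<in> ?F. succs_refl I i)"
      then obtain i where i: "i \<in> ?F" "u \<in> succs_refl I i" by blast
      then have "i \<in> ancestors I u" by (simp add: ancestors_iff succs_refl_iff)
      with i have "u \<notin> finished I R t"
        using ancestors_subset_finished[of u I R t] by (auto simp: front_def)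
      with i show "u \<in> jobs I - finished I R t"
        using succs_refl_subset[OF assms] front_subset by blast
    qed
  qed (use out_forest_instD[OF assms] in auto)
  finally show ?thesis .
qed

section \<open>Cost and lower bounds for arbitrary schedules\<close>

lemma completion_time_le: "j \<in> finished I R t \<Longrightarrow> completion_time I R j \<le> t"
  unfolding completion_time_def by (rule Least_le)

lemma finished_completion_time:
  assumes "feasible I R" "j \<in> jobs I"
  shows "j \<in> finished I R (completion_time I R j)"
  unfolding completion_time_def
  by (rule LeastI_ex) (use assms in \<open>auto simp: feasible_def\<close>)

lemma finished_iff:
  assumes "feasible I R" "j \<in> jobs I"
  shows "j \<in> finished I R t \<longleftrightarrow> completion_time I R j \<le> t"
  using completion_time_le finished_completion_time[OF assms] finished_mono by blast

lemma cost_nonneg: "out_forest_inst I \<Longrightarrow> 0 \<le> cost I R"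
  unfolding cost_def by (rule sum_nonneg) (use out_forest_instD(6) in auto)

text \<open>Counting by time instead of by job: \<open>j\<close> is unfinished at exactly the first
  \<open>completion_time I R j\<close> points of time.\<close>

lemma sum_pending_weight:
  assumes "out_forest_inst I" "feasible I R"
    and "\<And>j. j \<in> jobs I \<Longrightarrow> completion_time I R j \<le> N"
  shows "(\<Sum>t<N. pending_weight I R t) = cost I R"
proof -
  have "(\<Sum>t<N. pending_weight I R t)
      = (\<Sum>t<N. \<Sum>j \<in> jobs I. if t < completion_time I R j then weight I j else 0)"
    unfolding pending_weight_def
    by (intro sum.cong refl sum.mono_neutral_cong_left)
      (use out_forest_instD(1)[OF assms(1)] finished_iff[OF assms(2)] in \<open>auto simp: not_le\<close>)
  also have "\<dots> = (\<Sum>j \<in> jobs I. \<Sum>t<N. if t < completion_time I R j then weight I j else 0)"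
    by (rule sum.swap)
  also have "\<dots> = cost I R"
    unfolding cost_def
  proof (rule sum.cong)
    fix j assume "j \<in> jobs I"
    then have "{..<N} \<inter> {t. t < completion_time I R j} = {..<completion_time I R j}"
      using assms(3) by fastforce
    then show "(\<Sum>t<N. if t < completion_time I R j then weight I j else 0)
        = weight I j * real (completion_time I R j)"
      by (simp add: sum.If_cases)
  qed simp
  finally show ?thesis .
qed

lemma sum_proc_finished_le:
  assumes "out_forest_inst I" "feasible I R"
  shows "(\<Sum>j \<in> finished I R t. proc I j) \<le> real t"
proof -
  have "(\<Sum>j \<in> finished I R t. proc I j) \<le> (\<Sum>j \<in> finished I R t. \<Sum>s=1..t. R s j)"
    by (rule sum_mono) (rule finished_imp_processed[OF assms(2)])
  also have "\<dots> = (\<Sum>s=1..t. \<Sum>j \<in> finished I R t. R s j)"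
    by (rule sum.swap)
  also have "\<dots> \<le> (\<Sum>s=1..t. 1)"
  proof (rule sum_mono)
    fix s assume "s \<in> {1..t}"
    then obtain s' where s: "s = Suc s'" by (cases s) auto
    have "(\<Sum>j \<in> finished I R t. R s j) \<le> (\<Sum>j \<in> jobs I. R s j)"
      by (rule sum_mono2)
        (use out_forest_instD(1)[OF assms(1)] finished_subset assms(2) s in
          \<open>auto simp: feasible_def\<close>)
    also have "\<dots> \<le> 1" using assms(2) s by (simp add: feasible_def)
    finally show "(\<Sum>j \<in> finished I R t. R s j) \<le> 1" .
  qed
  finally show ?thesis by simp
qed

text \<open>A job completes at least one slot after its parent, even if it requires no processing.
  Losses from rounding to whole slots are charged against this bound.\<close>

lemma card_ancestors_le:
  assumes "out_forest_inst I"
  shows "j \<in> finished I R t \<Longrightarrow> card (ancestors I j) \<le> t"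
  using assms
proof (induction j arbitrary: t rule: forest_induct)
  case (root j)
  then show ?case by (cases t) (auto simp: ancestors_def)
next
  case (child i j)
  define t0 where "t0 = (LEAST t. j \<in> finished I R t)"
  have t0: "j \<in> finished I R t0" unfolding t0_def using child.prems by (rule LeastI)
  have le: "t0 \<le> t" unfolding t0_def using child.prems by (rule Least_le)
  obtain t' where t': "t0 = Suc t'" using t0 by (cases t0) auto
  have "j \<notin> finished I R t'"
    using not_less_Least[of t' "\<lambda>t. j \<in> finished I R t"] t' by (simp add: t0_def)
  with t0 t' have "preds I j \<subseteq> finished I R t'" by auto
  then have "i \<in> finished I R t'" using child.hyps by (auto simp: ancestors_def)
  then have "card (ancestors I i) \<le> t'" by (rule child.IH)
  then have "card (ancestors I j) \<le> Suc t'"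
    using child.hyps finite_ancestors[OF assms, of i]
    by (metis ancestors_def card_insert_le_m1 card_insert_if le_SucI Suc_le_mono)
  with t' le show ?case by simp
qed

section \<open>Sharing the machine evenly\<close>

text \<open>Here \<open>1 / k\<close> is a lower bound on the rates of front jobs; the additional
  slot rounds the running time \<open>k * proc I j\<close> up to an integer.\<close>

lemma finished_within_rate:
  assumes "k > 0" "\<And>s j. j \<in> front I R s \<Longrightarrow> 1 \<le> k * R (Suc s) j"
    and "\<And>s j. 0 \<le> R (Suc s) j"
    and "j \<in> visible I R t" "0 \<le> proc I j"
  shows "\<exists>t'. j \<in> finished I R t' \<and> real t' \<le> real t + k * proc I j + 1"
proof -
  define n where "n = nat \<lfloor>k * proc I j\<rfloor>"
  have kp: "0 \<le> k * proc I j" using assms by simp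
  then have n: "real n \<le> k * proc I j" "k * proc I j \<le> real (Suc n)"
    unfolding n_def by linarith+
  have "j \<in> finished I R (t + Suc n)"
  proof (rule ccontr)
    assume not: "j \<notin> finished I R (t + Suc n)"
    have front: "j \<in> front I R s" if "t \<le> s" "s < t + Suc n" for s
      using assms(4) visible_mono[OF that(1)] not finished_mono[of s "t + Suc n" I R] that
      by (auto simp: front_def)
    have "real (Suc n) = (\<Sum>s=t..<t + Suc n. 1)" by simp
    also have "\<dots> \<le> (\<Sum>s=t..<t + Suc n. k * R (Suc s) j)"
      by (rule sum_mono) (use assms(2) front in auto)
    also have "\<dots> = k * (\<Sum>s=t..<t + Suc n. R (Suc s) j)"
      by (rule sum_distrib_left[symmetric])
    also have "\<dots> \<le> k * (\<Sum>s=0..<t + Suc n. R (Suc s) j)"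
      by (intro mult_left_mono sum_mono2) (use assms in auto)
    also have "(\<Sum>s=0..<t + Suc n. R (Suc s) j) = (\<Sum>s=1..t + Suc n. R s j)"
      using sum.shift_bounds_Suc_ivl[of "\<lambda>s. R s j" 0 "t + Suc n"]
      by (simp add: atLeastLessThanSuc_atLeastAtMost)
    finally have "k * proc I j \<le> k * (\<Sum>s=1..t + Suc n. R s j)" using n(2) by linarith
    then have "proc I j \<le> (\<Sum>s=1..Suc (t + n). R s j)"
      using assms(1) by simp
    moreover have "j \<in> front I R (t + n)" using front by simp
    ultimately have "j \<in> finished I R (Suc (t + n))"
      by (simp add: front_def visible_def)
    with not show False by simp
  qed
  with n(1) show ?thesis by (intro exI[of _ "t + Suc n"]) auto
qed

lemma finished_along_chain:
  assumes "out_forest_inst I" "k > 0" "\<And>s j. j \<in> front I R s \<Longrightarrow> 1 \<le> k * R (Suc s) j"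
    and "\<And>s j. 0 \<le> R (Suc s) j" "j \<in> jobs I"
  shows "\<exists>t. j \<in> finished I R t \<and> real t \<le> (\<Sum>i \<in> ancestors I j. k * proc I i + 1)"
  using assms(1,5)
proof (induction j rule: forest_induct)
  case (root j)
  then have "j \<in> visible I R 0" by (simp add: visible_def)
  from finished_within_rate[OF assms(2-4) this] root show ?case
    using out_forest_instD(5)[OF assms(1)] by (auto simp: ancestors_def)
next
  case (child i j)
  have "i \<in> jobs I" using child out_forest_instD(2)[OF assms(1)] by blast
  then obtain t where t: "i \<in> finished I R t"
    "real t \<le> (\<Sum>i \<in> ancestors I i. k * proc I i + 1)"
    using child.IH by blast
  then have "j \<in> visible I R t"
    using child ancestors_subset_finished by (simp add: visible_def)
  from finished_within_rate[OF assms(2-4) this] child.prems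
  obtain t' where t': "j \<in> finished I R t'" "real t' \<le> real t + k * proc I j + 1"
    using out_forest_instD(5)[OF assms(1)] by blast
  have "(\<Sum>i \<in> ancestors I j. k * proc I i + 1)
      = k * proc I j + 1 + (\<Sum>i \<in> ancestors I i. k * proc I i + 1)"
    using not_in_preds[OF assms(1), of j] finite_ancestors[OF assms(1), of i] child.hyps(2)
    by (simp add: ancestors_def[of I j])
  with t t' show ?case by (intro exI[of _ t']) auto
qed

text \<open>The comparison is job by job: if \<open>R'\<close> finishes \<open>j\<close> by time
  \<open>T\<close>, then both the total requirement and the length of the path to \<open>j\<close>
  are at most \<open>T\<close>. The former accounts for \<open>k\<close>, the latter, through
  rounding, for the summand 1.\<close>

lemma cost_le_even_share:
  assumes "out_forest_inst I" "k > 0" "\<And>s j. j \<in> front I R s \<Longrightarrow> 1 \<le> k * R (Suc s) j"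
    and "\<And>s j. 0 \<le> R (Suc s) j" "feasible I R'"
  shows "cost I R \<le> (k + 1) * cost I R'"
  unfolding cost_def sum_distrib_left
proof (rule sum_mono)
  fix j assume j: "j \<in> jobs I"
  define T where "T = completion_time I R' j"
  have T: "j \<in> finished I R' T"
    unfolding T_def by (rule finished_completion_time[OF assms(5) j])
  obtain t where t: "j \<in> finished I R t" "real t \<le> (\<Sum>i \<in> ancestors I j. k * proc I i + 1)"
    using finished_along_chain[where k = k and R = R, OF assms(1-4) j] by blast
  have "(\<Sum>i \<in> ancestors I j. proc I i) \<le> (\<Sum>i \<in> finished I R' T. proc I i)"
    by (rule sum_mono2)
      (use ancestors_subset_finished[OF T] finished_subset[of I R' T] out_forest_instD[OF assms(1)]
          finite_subset in blast)+
  also have "\<dots> \<le> real T" by (rule sum_proc_finished_le[OF assms(1,5)])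
  finally have "k * (\<Sum>i \<in> ancestors I j. proc I i) \<le> k * real T"
    using assms(2) by simp
  moreover have "card (ancestors I j) \<le> T" by (rule card_ancestors_le[OF assms(1) T])
  ultimately have "real t \<le> (k + 1) * real T"
    using t(2) by (simp add: sum.distrib sum_distrib_left[symmetric] algebra_simps)
  moreover have "completion_time I R j \<le> t" using t(1) by (rule completion_time_le)
  ultimately have "real (completion_time I R j) \<le> (k + 1) * real T" by linarith
  from mult_left_mono[OF this out_forest_instD(6)[OF assms(1) j]]
  show "weight I j * real (completion_time I R j)
      \<le> (k + 1) * (weight I j * real (completion_time I R' j))"
    by (simp add: T_def algebra_simps)
qed

section \<open>Sharing the machine in proportion to the weight of the successors\<close>

text \<open>No rate is wasted in a slot that leaves \<open>a\<close> unfinished: after the last slot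
  of \<open>B\<close>, \<open>a\<close> is visible and unfinished, so it has received less than its
  requirement.\<close>

lemma processing_before_last_slot_le:
  assumes "feasible I R" "finite B" "a \<in> jobs I" "0 \<le> proc I a"
    and "\<And>s. s \<in> B \<Longrightarrow> a \<in> front I R s \<and> a \<notin> finished I R (Suc s)"
  shows "(\<Sum>s \<in> B. R (Suc s) a) \<le> proc I a"
proof (cases "B = {}")
  case False
  define m where "m = Max B"
  have m: "m \<in> B" "\<And>s. s \<in> B \<Longrightarrow> s \<le> m"
    using assms(2) False by (auto simp: m_def)
  have "(\<Sum>s \<in> B. R (Suc s) a) \<le> (\<Sum>s=0..<Suc m. R (Suc s) a)"
    by (rule sum_mono2) (use m(2) assms(1) in \<open>auto simp: feasible_def less_Suc_eq_le\<close>)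
  also have "\<dots> = (\<Sum>s=1..Suc m. R s a)"
    using sum.shift_bounds_Suc_ivl[of "\<lambda>s. R s a" 0 "Suc m"]
    by (simp only: atLeastLessThanSuc_atLeastAtMost One_nat_def)
  also have "\<dots> \<le> proc I a"
    using assms(3) assms(5)[OF m(1)] by (auto simp: front_def visible_def)
  finally show ?thesis .
qed (use assms(4) in simp)

lemma card_last_slots_le_1: "card {s \<in> B. a \<notin> finished I R s \<and> a \<in> finished I R (Suc s)} \<le> 1"
proof -
  let ?S = "{s \<in> B. a \<notin> finished I R s \<and> a \<in> finished I R (Suc s)}"
  have "s = s'" if "s \<in> ?S" "s' \<in> ?S" for s s'
    using that finished_mono[of "Suc s" s' I R] finished_mono[of "Suc s'" s I R]
    by (metis (mono_tags, lifting) Suc_leI linorder_neqE_nat mem_Collect_eq subsetD)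
  then have "?S \<subseteq> {s}" if "s \<in> ?S" for s using that by blast
  then show ?thesis
    by (metis (no_types, lifting) all_not_in_conv card.empty card_mono finite.intros is_singletonI
        is_singleton_altdef zero_le)
qed

text \<open>Double counting: in every slot from \<open>h\<close> to \<open>t\<close>, each job of
  \<open>X\<close> charges its weight to an ancestor in the front. The charges are bounded by the
  processing of \<open>D\<close> plus one slot per ancestor, which leaves too little for
  \<open>t - h\<close> slots.\<close>

lemma pending_weight_le_quarter:
  assumes I: "out_forest_inst I" and R: "feasible I R" and R': "feasible I R'" and "0 \<le> \<kappa>"
    and rate: "\<And>s j. j \<in> front I R s \<Longrightarrow>
      succ_weight I j \<le> \<kappa> * pending_weight I R s * R (Suc s) j"
    and t: "(16 * \<kappa> + 3) * real T \<le> real t"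
  shows "pending_weight I R t \<le> pending_weight I R (t div 2) / 4 + 2 * pending_weight I R' T"
proof (rule ccontr)
  let ?W = "pending_weight I R"
  let ?F = "finished I R"
  let ?w = "weight I"
  define D where "D = finished I R' T"
  define X where "X = D - ?F t"
  define wX where "wX = (\<Sum>x \<in> X. ?w x)"
  define h where "h = t div 2"
  assume "\<not> ?thesis"
  then have not: "?W h / 4 + 2 * pending_weight I R' T < ?W t" by (simp add: h_def)
  \<comment> \<open>Both summands on the left of \<open>not\<close> are nonnegative, so each alone
    is below \<open>?W t\<close>.\<close>
  have W_h: "?W h < 4 * ?W t" and W': "2 * pending_weight I R' T < ?W t"
    using not pending_weight_nonneg[OF I, of R h] pending_weight_nonneg[OF I, of R' T] by linarith+
  have jobs: "finite (jobs I)" by (rule out_forest_instD(1)[OF I])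
  have D: "D \<subseteq> jobs I" unfolding D_def by (rule finished_subset)
  have fin: "finite D" "finite X"
    using D jobs by (auto simp: X_def intro: finite_subset)
  have w: "0 \<le> ?w j" if "j \<in> jobs I" for j by (rule out_forest_instD(6)[OF I that])
  have X: "x \<in> D" "x \<notin> ?F t" "x \<in> jobs I" "ancestors I x \<subseteq> D" "finite (ancestors I x)"
    if "x \<in> X" for x
    using that D ancestors_subset_finished[of x I R' T] finite_ancestors[OF I]
    by (auto simp: X_def D_def)

  \<comment> \<open>Unfinished weight outside \<open>X\<close> is also unfinished at
    \<open>T\<close> in \<open>R'\<close>, hence less than half of \<open>?W t\<close>.\<close>
  have "?W t \<le> (\<Sum>j \<in> X \<union> (jobs I - D). ?w j)"
    unfolding pending_weight_def by (rule sum_mono2) (use X(3) jobs w fin(2) in \<open>auto simp: X_def\<close>)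
  also have "\<dots> \<le> wX + pending_weight I R' T"
    unfolding wX_def pending_weight_def D_def[symmetric]
    by (subst sum.union_disjoint) (use jobs fin(2) X(1) in auto)
  finally have half: "?W t < 2 * wX" using W' by linarith
  have W_t: "0 \<le> ?W t" by (rule pending_weight_nonneg[OF I])
  have wX: "0 < wX" using half W_t by linarith

  \<comment> \<open>Only in the slot in which a job completes can part of its rate be wasted, so
    these slots are counted separately.\<close>
  define L where "L s = {a. a \<in> front I R s \<and> a \<in> ?F (Suc s)}" for s
  define M where "M s = {a. a \<in> front I R s \<and> a \<notin> ?F (Suc s)}" for s

  have "real (t - h) * wX = (\<Sum>s=h..<t. \<Sum>x \<in> X. ?w x)"
    by (simp add: wX_def)
  also have "\<dots> \<le> (\<Sum>s=h..<t. \<Sum>x \<in> X. \<Sum>a \<in> ancestors I x.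
      (if a \<in> L s then ?w x else 0) + (if a \<in> M s then ?w x else 0))"
  proof (intro sum_mono)
    fix s x assume s: "s \<in> {h..<t}" and x: "x \<in> X"
    have "x \<notin> ?F s" using X[OF x] s finished_mono[of s t I R] by auto
    then obtain a where a: "a \<in> ancestors I x" "a \<in> front I R s"
      using front_ancestor_exists[OF I X(3)[OF x]] by blast
    have "?w x = (if a \<in> L s then ?w x else 0) + (if a \<in> M s then ?w x else 0)"
      using a(2) by (auto simp: L_def M_def)
    also have "\<dots> \<le> (\<Sum>a \<in> ancestors I x.
        (if a \<in> L s then ?w x else 0) + (if a \<in> M s then ?w x else 0))"
      by (rule member_le_sum) (use a(1) X[OF x] w in auto)
    finally show "?w x \<le> \<dots>" .
  qed
  also have "\<dots> = (\<Sum>s=h..<t. \<Sum>x \<in> X. \<Sum>a \<in> ancestors I x. if a \<in> L s then ?w x else 0)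
      + (\<Sum>s=h..<t. \<Sum>x \<in> X. \<Sum>a \<in> ancestors I x. if a \<in> M s then ?w x else 0)"
    by (simp add: sum.distrib)
  finally have split: "real (t - h) * wX \<le> \<dots>" .

  \<comment> \<open>Each ancestor completes in one slot only, and \<open>x\<close> has at most
    \<open>T\<close> ancestors because \<open>R'\<close> finishes it by time
    \<open>T\<close>.\<close>
  have "(\<Sum>s=h..<t. \<Sum>x \<in> X. \<Sum>a \<in> ancestors I x. if a \<in> L s then ?w x else 0)
      = (\<Sum>x \<in> X. \<Sum>a \<in> ancestors I x. \<Sum>s=h..<t. if a \<in> L s then ?w x else 0)"
    by (subst sum.swap, rule sum.cong[OF refl], rule sum.swap)
  also have "\<dots> \<le> (\<Sum>x \<in> X. \<Sum>a \<in> ancestors I x. ?w x)"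
  proof (intro sum_mono)
    fix x a assume x: "x \<in> X"
    have "card {s \<in> {h..<t}. a \<in> L s} \<le> card {s \<in> {h..<t}. a \<notin> ?F s \<and> a \<in> ?F (Suc s)}"
      by (rule card_mono) (auto simp: L_def front_def)
    also have "\<dots> \<le> 1" by (rule card_last_slots_le_1)
    finally have "real (card {s \<in> {h..<t}. a \<in> L s}) * ?w x \<le> 1 * ?w x"
      by (intro mult_right_mono) (use X[OF x] w in auto)
    then show "(\<Sum>s=h..<t. if a \<in> L s then ?w x else 0) \<le> ?w x"
      by (simp add: sum.If_cases Int_def)
  qed
  also have "\<dots> = (\<Sum>x \<in> X. real (card (ancestors I x)) * ?w x)" by simp
  also have "\<dots> \<le> (\<Sum>x \<in> X. real T * ?w x)"
    by (intro sum_mono mult_right_mono)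
      (use card_ancestors_le[OF I, of _ R' T] X w in \<open>auto simp: D_def\<close>)
  also have "\<dots> = real T * wX" by (simp add: wX_def sum_distrib_left)
  finally have last: "(\<Sum>s=h..<t. \<Sum>x \<in> X. \<Sum>a \<in> ancestors I x. if a \<in> L s then ?w x else 0)
      \<le> real T * wX" .

  \<comment> \<open>After swapping the sums, \<open>a\<close> is charged at most the weight of its
    successors, which \<open>rate\<close> converts into processing of \<open>a\<close>.\<close>
  have inner: "(\<Sum>x \<in> X. \<Sum>a \<in> ancestors I x. if a \<in> M s then ?w x else 0)
      \<le> 4 * \<kappa> * ?W t * (\<Sum>a \<in> D. if a \<in> M s then R (Suc s) a else 0)" if s: "s \<in> {h..<t}" for s
  proof -
    have "(\<Sum>x \<in> X. \<Sum>a \<in> ancestors I x. if a \<in> M s then ?w x else 0)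
        = (\<Sum>x \<in> X. \<Sum>a \<in> D. if a \<in> M s \<and> a \<in> ancestors I x then ?w x else 0)"
      by (intro sum.cong refl sum.mono_neutral_cong_left) (use X fin in auto)
    also have "\<dots> = (\<Sum>a \<in> D. \<Sum>x \<in> X. if a \<in> M s \<and> a \<in> ancestors I x then ?w x else 0)"
      by (rule sum.swap)
    also have "\<dots> \<le> (\<Sum>a \<in> D. 4 * \<kappa> * ?W t * (if a \<in> M s then R (Suc s) a else 0))"
    proof (rule sum_mono)
      fix a assume a: "a \<in> D"
      show "(\<Sum>x \<in> X. if a \<in> M s \<and> a \<in> ancestors I x then ?w x else 0)
          \<le> 4 * \<kappa> * ?W t * (if a \<in> M s then R (Suc s) a else 0)"
      proof (cases "a \<in> M s")
        case True
        then have front: "a \<in> front I R s" by (simp add: M_def)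
        have "(\<Sum>x \<in> X. if a \<in> ancestors I x then ?w x else 0)
            = (\<Sum>x \<in> {x \<in> X. a \<in> ancestors I x}. ?w x)"
          using fin by (simp add: sum.inter_filter)
        also have "\<dots> \<le> succ_weight I a"
          unfolding succ_weight_def
        proof (rule sum_mono2)
          show "finite (succs_refl I a)" using a D finite_succs_refl[OF I] by blast
          show "{x \<in> X. a \<in> ancestors I x} \<subseteq> succs_refl I a"
            by (auto simp: ancestors_iff succs_refl_iff)
          show "0 \<le> ?w x" if "x \<in> succs_refl I a - {x \<in> X. a \<in> ancestors I x}" for x
            using that a D succs_refl_subset[OF I, of a] w by blast
        qed
        also have "\<dots> \<le> \<kappa> * ?W s * R (Suc s) a" by (rule rate[OF front])
        \<comment> \<open>From \<open>h\<close> on the unfinished weight is at most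
          \<open>?W h\<close>, so the varying \<open>?W s\<close> is replaced by a fixed multiple of
          \<open>?W t\<close>.\<close>
        also have "\<dots> \<le> \<kappa> * (4 * ?W t) * R (Suc s) a"
          using pending_weight_antimono[OF I, of h s R] s W_h R \<open>0 \<le> \<kappa>\<close>
          by (intro mult_right_mono mult_left_mono) (auto simp: feasible_def)
        finally show ?thesis using True by (simp add: algebra_simps)
      qed simp
    qed
    finally show ?thesis by (simp add: sum_distrib_left)
  qed
  have "(\<Sum>s=h..<t. \<Sum>x \<in> X. \<Sum>a \<in> ancestors I x. if a \<in> M s then ?w x else 0)
      \<le> (\<Sum>s=h..<t. 4 * \<kappa> * ?W t * (\<Sum>a \<in> D. if a \<in> M s then R (Suc s) a else 0))"
    by (rule sum_mono) (rule inner)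
  also have "\<dots> = 4 * \<kappa> * ?W t * (\<Sum>a \<in> D. \<Sum>s=h..<t. if a \<in> M s then R (Suc s) a else 0)"
    by (subst sum.swap) (simp add: sum_distrib_left)
  also have "\<dots> \<le> 4 * \<kappa> * ?W t * (\<Sum>a \<in> D. proc I a)"
  proof (intro mult_left_mono sum_mono)
    fix a assume a: "a \<in> D"
    have "(\<Sum>s=h..<t. if a \<in> M s then R (Suc s) a else 0)
        = (\<Sum>s \<in> {s \<in> {h..<t}. a \<in> M s}. R (Suc s) a)"
      by (rule sum.inter_filter[symmetric]) simp
    also have "\<dots> \<le> proc I a"
      by (rule processing_before_last_slot_le[OF R])
        (use a D out_forest_instD(5)[OF I] in \<open>auto simp: M_def\<close>)
    finally show "(\<Sum>s=h..<t. if a \<in> M s then R (Suc s) a else 0) \<le> proc I a" .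
  qed (use \<open>0 \<le> \<kappa>\<close> W_t in simp)
  also have "\<dots> \<le> 4 * \<kappa> * ?W t * real T"
    unfolding D_def
    by (intro mult_left_mono sum_proc_finished_le[OF I R']) (use \<open>0 \<le> \<kappa>\<close> W_t in simp)
  also have "\<dots> \<le> 4 * \<kappa> * (2 * wX) * real T"
    using half \<open>0 \<le> \<kappa>\<close> by (intro mult_right_mono mult_left_mono) auto
  finally have before: "(\<Sum>s=h..<t. \<Sum>x \<in> X. \<Sum>a \<in> ancestors I x. if a \<in> M s then ?w x else 0)
      \<le> 4 * \<kappa> * (2 * wX) * real T" .

  \<comment> \<open>Cancelling \<open>wX\<close> and doubling gives at most
    \<open>(16 * \<kappa> + 2) * T\<close> for \<open>t\<close>. This contradicts the assumption on
    \<open>t\<close> as soon as \<open>T\<close> is positive; for \<open>T = 0\<close> the set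
    \<open>X\<close> would be empty.\<close>
  have "real (t - h) * wX \<le> ((8 * \<kappa> + 1) * real T) * wX"
    using split last before by (simp add: algebra_simps)
  then have "real (t - h) \<le> (8 * \<kappa> + 1) * real T" using wX by simp
  moreover have "real t \<le> 2 * real (t - h)" unfolding h_def by linarith
  moreover have "0 < T"
  proof (rule ccontr)
    assume "\<not> 0 < T"
    then have "X = {}" by (simp add: X_def D_def)
    with wX show False by (simp add: wX_def)
  qed
  ultimately show False using t by (simp add: algebra_simps)
qed

text \<open>Each value of \<open>t div m\<close> is attained by \<open>m\<close> consecutive
  arguments.\<close>

lemma sum_div_le:
  fixes g :: "nat \<Rightarrow> real"
  assumes "\<And>n. 0 \<le> g n" "0 < m"
  shows "(\<Sum>t<n. g (t div m)) \<le> real m * (\<Sum>t<n. g t)"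
proof -
  have "n \<le> n * m" using assms(2) by simp
  then have "(\<Sum>t<n. g (t div m)) \<le> (\<Sum>t<n * m. g (t div m))"
    by (intro sum_mono2) (use assms(1) in auto)
  also have "\<dots> = (\<Sum>i<n. \<Sum>t=i * m..<i * m + m. g (t div m))"
    by (rule sum.nat_group[symmetric])
  also have "\<dots> = (\<Sum>i<n. \<Sum>t=i * m..<i * m + m. g i)"
  proof (intro sum.cong refl)
    fix i t assume "t \<in> {i * m..<i * m + m}"
    then have "t div m = i" by (intro div_nat_eqI) (auto simp: algebra_simps)
    then show "g (t div m) = g i" by simp
  qed
  also have "\<dots> = real m * (\<Sum>t<n. g t)" by (simp add: sum_distrib_left)
  finally show ?thesis .
qed

lemma cost_le_proportional_share:
  assumes I: "out_forest_inst I" and R: "feasible I R" and R': "feasible I R'" and "0 \<le> \<kappa>"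
    and rate: "\<And>s j. j \<in> front I R s \<Longrightarrow>
      succ_weight I j \<le> \<kappa> * pending_weight I R s * R (Suc s) j"
  shows "cost I R \<le> (64 * \<kappa> + 16) * cost I R'"
proof -
  \<comment> \<open>An integer is needed so that \<open>T = t div m\<close> satisfies the hypothesis
    of \<open>pending_weight_le_quarter\<close>.\<close>
  define m where "m = nat \<lceil>16 * \<kappa> + 3\<rceil>"
  have m: "16 * \<kappa> + 3 \<le> real m" "real m \<le> 16 * \<kappa> + 4" "0 < m"
    using \<open>0 \<le> \<kappa>\<close> unfolding m_def by linarith+
  \<comment> \<open>The 0 keeps the maximum defined when there are no jobs.\<close>
  define N where
    "N = Max (insert 0 (completion_time I R ` jobs I \<union> completion_time I R' ` jobs I))"
  have N: "completion_time I R j \<le> N" "completion_time I R' j \<le> N" if "j \<in> jobs I" for j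
    unfolding N_def using that out_forest_instD(1)[OF I] by (auto intro!: Max_ge)
  have step: "pending_weight I R t
      \<le> pending_weight I R (t div 2) / 4 + 2 * pending_weight I R' (t div m)" for t
  proof (rule pending_weight_le_quarter[OF I R R' \<open>0 \<le> \<kappa>\<close> rate])
    have "(16 * \<kappa> + 3) * real (t div m) \<le> real m * real (t div m)"
      using m by (intro mult_right_mono) auto
    also have "\<dots> \<le> real t"
      by (metis of_nat_le_iff of_nat_mult times_div_less_eq_dividend)
    finally show "(16 * \<kappa> + 3) * real (t div m) \<le> real t" .
  qed
  have "cost I R = (\<Sum>t<N. pending_weight I R t)"
    using sum_pending_weight[OF I R N(1)] by simp
  also have "\<dots> \<le> (\<Sum>t<N. pending_weight I R (t div 2) / 4 + 2 * pending_weight I R' (t div m))"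
    by (rule sum_mono) (rule step)
  also have "\<dots> = (\<Sum>t<N. pending_weight I R (t div 2)) / 4
      + 2 * (\<Sum>t<N. pending_weight I R' (t div m))"
    by (simp add: sum.distrib sum_distrib_left sum_divide_distrib)
  \<comment> \<open>Sampling at \<open>t div 2\<close> doubles the sum, so with the factor 1/4 half
    of the cost of \<open>R\<close> remains and can be absorbed on the left.\<close>
  also have "\<dots> \<le> (real 2 * (\<Sum>t<N. pending_weight I R t)) / 4
      + 2 * (real m * (\<Sum>t<N. pending_weight I R' t))"
    by (intro add_mono divide_right_mono mult_left_mono sum_div_le pending_weight_nonneg[OF I])
      (use m in auto)
  also have "\<dots> = cost I R / 2 + 2 * (real m * cost I R')"
    using sum_pending_weight[OF I R N(1)] sum_pending_weight[OF I R' N(2)] by simp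
  finally have "cost I R \<le> 4 * real m * cost I R'" by simp
  also have "\<dots> \<le> (64 * \<kappa> + 16) * cost I R'"
    using m cost_nonneg[OF I] by (intro mult_right_mono) auto
  finally show ?thesis .
qed

section \<open>The algorithm\<close>

text \<open>If all predictions in the front are 0, the first summand is \<open>0 / 0 = 0\<close>.\<close>

definition share :: algorithm where
  "share h j = (case last h j of
      None \<Rightarrow> 0
    | Some (_, f) \<Rightarrow> f / (2 * (\<Sum>i \<in> dom (last h). snd (the (last h i))))
        + 1 / (2 * real (card (dom (last h)))))"

lemma run_share:
  fixes I t
  defines "F \<equiv> front I (run share I) t"
  shows "run share I (Suc t) j =
    (if j \<in> F then forecast I j / (2 * (\<Sum>i \<in> F. forecast I i)) + 1 / (2 * real (card F)) else 0)"
proof -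
  define obs where "obs = observe I (run share I) t"
  have obs: "obs i = (if i \<in> F then Some (weight I i, forecast I i) else None)" for i
    by (simp add: obs_def observe_def F_def)
  then have dom: "dom obs = F" by (auto split: if_splits)
  have forecasts: "(\<Sum>i \<in> F. snd (the (obs i))) = (\<Sum>i \<in> F. forecast I i)"
    by (rule sum.cong) (auto simp: obs)
  have last: "last (history I (run share I) t) = obs"
    by (simp add: history_def obs_def)
  show ?thesis
    unfolding run_Suc share_def[of "history I (run share I) t"] last dom forecasts
    by (simp add: obs)
qed

lemma forecast_nonneg: "out_forest_inst I \<Longrightarrow> j \<in> front I R t \<Longrightarrow> 0 \<le> forecast I j"
  by (rule out_forest_instD(7)[OF _ subsetD[OF front_subset]])

lemma sum_forecast_nonneg:
  "out_forest_inst I \<Longrightarrow> 0 \<le> (\<Sum>i \<in> front I R t. forecast I i)"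
  by (rule sum_nonneg) (rule forecast_nonneg)

lemma run_share_nonneg:
  assumes "out_forest_inst I"
  shows "0 \<le> run share I (Suc t) j"
  using sum_forecast_nonneg[OF assms] forecast_nonneg[OF assms] by (simp add: run_share)

lemma run_share_even:
  assumes "out_forest_inst I" "j \<in> front I (run share I) t"
  shows "1 \<le> (2 * real (width I)) * run share I (Suc t) j" "0 < width I"
proof -
  let ?n = "card (front I (run share I) t)"
  have n: "0 < ?n" using assms finite_front card_gt_0_iff by blast
  have le: "?n \<le> width I" by (rule card_front_le_width[OF assms(1)])
  show "0 < width I" using n le by simp
  have "0 \<le> forecast I j / (2 * (\<Sum>i \<in> front I (run share I) t. forecast I i))"
    using sum_forecast_nonneg[OF assms(1)] forecast_nonneg[OF assms] by simp
  then have "1 / (2 * real ?n) \<le> run share I (Suc t) j"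
    using assms(2) by (simp add: run_share)
  moreover have "1 / (2 * real (width I)) \<le> 1 / (2 * real ?n)"
    using n le by (intro divide_left_mono) auto
  ultimately have "1 / (2 * real (width I)) \<le> run share I (Suc t) j" by linarith
  with \<open>0 < width I\<close> show "1 \<le> (2 * real (width I)) * run share I (Suc t) j"
    by (simp add: field_simps)
qed

text \<open>At time 0 nothing is finished, so any job yields a nonempty front. This makes
  \<open>2 * width I\<close> an admissible \<open>k\<close> in the bounds for the even half.\<close>

lemma width_pos:
  assumes "out_forest_inst I" "j \<in> jobs I"
  shows "0 < width I"
proof -
  have "\<exists>i. i \<in> front I (run share I) 0"
    using front_ancestor_exists[OF assms, of "run share I" 0] by auto
  then show ?thesis using run_share_even(2)[OF assms(1)] by blast
qed

lemma feasible_run_share: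
  assumes "out_forest_inst I"
  shows "feasible I (run share I)"
  unfolding feasible_def
proof (intro conjI allI ballI)
  fix t
  let ?R = "run share I"
  let ?F = "front I ?R t"
  show "0 \<le> ?R (Suc t) j" for j by (rule run_share_nonneg[OF assms])
  show "?R (Suc t) j \<noteq> 0 \<longrightarrow> j \<in> visible I ?R t" for j
    by (simp add: run_share front_def)
  have "(\<Sum>j \<in> jobs I. ?R (Suc t) j)
      = (\<Sum>j \<in> ?F. forecast I j / (2 * (\<Sum>i \<in> ?F. forecast I i)) + 1 / (2 * real (card ?F)))"
    by (rule sum.mono_neutral_cong_right)
      (use out_forest_instD(1)[OF assms] front_subset in \<open>auto simp: run_share\<close>)
  also have "\<dots> = (\<Sum>j \<in> ?F. forecast I j) / (2 * (\<Sum>i \<in> ?F. forecast I i))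
      + real (card ?F) / (2 * real (card ?F))"
    by (simp add: sum.distrib sum_divide_distrib)
  \<comment> \<open>Each quotient is 1/2, or 0 if its divisor vanishes, since division by 0 yields
    0.\<close>
  also have "\<dots> \<le> 1 / 2 + 1 / 2"
    by (intro add_mono) auto
  finally show "(\<Sum>j \<in> jobs I. ?R (Suc t) j) \<le> 1" by simp
next
  fix j assume j: "j \<in> jobs I"
  \<comment> \<open>The even half alone makes every job complete, whatever the predictions
    are.\<close>
  from finished_along_chain[where k = "2 * real (width I)" and R = "run share I",
      OF assms _ run_share_even(1)[OF assms] run_share_nonneg[OF assms] j]
  show "\<exists>t. j \<in> finished I (run share I) t"
    using width_pos[OF assms j] by auto
qed

section \<open>The prediction error as a pair of real factors\<close>

lemma quot_le_imp:
  assumes "quot a b \<le> ennreal c" "0 \<le> a" "0 \<le> b" "0 \<le> c"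
  shows "a \<le> c * b"
proof (cases "b = 0")
  case True
  have "a = 0"
  proof (rule ccontr)
    assume "a \<noteq> 0"
    with True assms(2) have "quot a b = top"
      by (simp add: quot_def)
    with assms(1) show False by (simp add: top_unique)
  qed
  with True show ?thesis by simp
next
  case False
  with assms have "ennreal (a / b) \<le> ennreal c"
    by (simp add: quot_def divide_ennreal)
  with False assms show ?thesis by (simp add: field_simps)
qed

text \<open>A finite error is traded for real factors \<open>u\<close> and \<open>v\<close>. The
  bound \<open>1 \<le> u * v\<close> later absorbs an additive constant; it is conditional on a job
  because suprema over the empty set are 0.\<close>

lemma prediction_error_bounds:
  assumes I: "out_forest_inst I" and "prediction_error I \<noteq> top"
  obtains u v where "0 \<le> u" "0 \<le> v" "prediction_error I = ennreal (u * v)"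
    "\<And>j. j \<in> jobs I \<Longrightarrow> forecast I j \<le> u * succ_weight I j"
    "\<And>j. j \<in> jobs I \<Longrightarrow> succ_weight I j \<le> v * forecast I j"
    "\<And>j. j \<in> jobs I \<Longrightarrow> 1 \<le> u * v"
proof -
  define u v where "u = enn2real (max_overestimate I)" and "v = enn2real (max_underestimate I)"
  have uv: "0 \<le> u" "0 \<le> v" by (simp_all add: u_def v_def)
  have top: "max_overestimate I \<noteq> top" "max_underestimate I \<noteq> top"
    using assms(2) by (auto simp: prediction_error_def)
  then have eq: "max_overestimate I = ennreal u" "max_underestimate I = ennreal v"
    unfolding u_def v_def by (metis ennreal_enn2real less_top)+
  have quots: "quot (forecast I j) (succ_weight I j) \<le> ennreal u"
    "quot (succ_weight I j) (forecast I j) \<le> ennreal v" if "j \<in> jobs I" for j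
    unfolding eq[symmetric] max_overestimate_def max_underestimate_def
    using that by (auto intro: SUP_upper)
  note nonneg = out_forest_instD(7)[OF I] succ_weight_nonneg[OF I]
  have over: "forecast I j \<le> u * succ_weight I j" if "j \<in> jobs I" for j
    by (rule quot_le_imp) (use quots nonneg uv that in auto)
  have under: "succ_weight I j \<le> v * forecast I j" if "j \<in> jobs I" for j
    by (rule quot_le_imp) (use quots nonneg uv that in auto)
  have "1 \<le> u * v" if j: "j \<in> jobs I" for j
  proof (cases "forecast I j = 0")
    \<comment> \<open>A zero prediction cannot be cancelled, but both quotients are then
      \<open>0 / 0\<close> and count as 1.\<close>
    case True
    then have "succ_weight I j = 0" using under[OF j] nonneg(2)[OF j] by simp
    with True quots[OF j] have "1 \<le> u" "1 \<le> v"
      by (simp_all add: quot_def)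
    then show ?thesis using mult_mono[of 1 u 1 v] by simp
  next
    case False
    then have pos: "0 < forecast I j" using nonneg(1)[OF j] by simp
    have "1 * forecast I j \<le> u * v * forecast I j"
      using over[OF j] mult_left_mono[OF under[OF j] uv(1)] by (simp add: mult.assoc)
    with pos show ?thesis by (simp only: mult_le_cancel_right_pos)
  qed
  moreover have "prediction_error I = ennreal (u * v)"
    using top uv by (simp add: prediction_error_def eq ennreal_mult)
  ultimately show ?thesis using that uv over under by blast
qed

text \<open>The prediction of \<open>j\<close> is at least its true value divided by
  \<open>v\<close>, and the predictions in the front sum to at most \<open>u\<close> times the
  unfinished weight. The factor 2 reflects that only half of the machine is shared in this
  way.\<close>

lemma run_share_proportional:
  assumes I: "out_forest_inst I" and "0 \<le> u" "0 \<le> v"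
    and over: "\<And>j. j \<in> jobs I \<Longrightarrow> forecast I j \<le> u * succ_weight I j"
    and under: "\<And>j. j \<in> jobs I \<Longrightarrow> succ_weight I j \<le> v * forecast I j"
    and j: "j \<in> front I (run share I) t"
  shows "succ_weight I j \<le> 2 * (u * v) * pending_weight I (run share I) t * run share I (Suc t) j"
proof -
  let ?R = "run share I"
  let ?F = "front I ?R t"
  let ?W = "pending_weight I ?R t"
  define f where "f = (\<Sum>i \<in> ?F. forecast I i)"
  have jI: "j \<in> jobs I" using j front_subset by blast
  have W: "0 \<le> ?W" by (rule pending_weight_nonneg[OF I])
  have "f \<le> (\<Sum>i \<in> ?F. u * succ_weight I i)"
    unfolding f_def by (rule sum_mono) (use over front_subset in blast)
  also have "\<dots> \<le> u * ?W"
    using sum_front_succ_weight_le[OF I, of ?R t] \<open>0 \<le> u\<close>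
    by (simp add: sum_distrib_left[symmetric] mult_left_mono)
  finally have f: "f \<le> u * ?W" .
  show ?thesis
  proof (cases "forecast I j = 0")
    case True
    then have "succ_weight I j \<le> 0" using under[OF jI] by simp
    also have "0 \<le> 2 * (u * v) * ?W * ?R (Suc t) j"
      using W assms(2,3) run_share_nonneg[OF I] by simp
    finally show ?thesis .
  next
    case False
    then have pos: "0 < forecast I j" using forecast_nonneg[OF I j] by simp
    also have "forecast I j \<le> f"
      unfolding f_def by (rule member_le_sum) (use j forecast_nonneg[OF I] finite_front[OF I] in auto)
    finally have "0 < f" .
    have "forecast I j / (2 * f) \<le> ?R (Suc t) j"
      using j by (simp add: run_share f_def)
    then have "forecast I j \<le> 2 * f * ?R (Suc t) j"
      using \<open>0 < f\<close> by (simp add: field_simps)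
    also have "\<dots> \<le> 2 * (u * ?W) * ?R (Suc t) j"
      using f run_share_nonneg[OF I] by (intro mult_right_mono) auto
    finally have "v * forecast I j \<le> v * (2 * (u * ?W) * ?R (Suc t) j)"
      using \<open>0 \<le> v\<close> by (rule mult_left_mono)
    with under[OF jI] show ?thesis by (simp add: mult_ac)
  qed
qed

section \<open>The two cost bounds and their combination\<close>

lemma cost_run_share_le_width:
  assumes "out_forest_inst I" "feasible I R'"
  shows "cost I (run share I) \<le> 144 * real (width I) * cost I R'"
proof (cases "jobs I = {}")
  case False
  then have "1 \<le> width I" using width_pos[OF assms(1)] by fastforce
  then have "cost I (run share I) \<le> (2 * real (width I) + 1) * cost I R'"
    by (intro cost_le_even_share[where k = "2 * real (width I)" and R = "run share I",
          OF assms(1) _ run_share_even(1)[OF assms(1)]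
          run_share_nonneg[OF assms(1)] assms(2)]) auto
  \<comment> \<open>The constant is generous here; it matches the bound in terms of the prediction
    error, so that one constant serves the minimum.\<close>
  also have "\<dots> \<le> 144 * real (width I) * cost I R'"
    using \<open>1 \<le> width I\<close> cost_nonneg[OF assms(1)] by (intro mult_right_mono) auto
  finally show ?thesis .
qed (simp add: cost_def)

lemma cost_run_share_le_prediction_error:
  assumes I: "out_forest_inst I" and R': "feasible I R'" and "prediction_error I \<noteq> top"
  shows "cost I (run share I) \<le> 144 * enn2real (prediction_error I) * cost I R'"
proof (cases "jobs I = {}")
  case False
  obtain u v where uv: "0 \<le> u" "0 \<le> v" "prediction_error I = ennreal (u * v)"
    "\<And>j. j \<in> jobs I \<Longrightarrow> forecast I j \<le> u * succ_weight I j"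
    "\<And>j. j \<in> jobs I \<Longrightarrow> succ_weight I j \<le> v * forecast I j"
    "\<And>j. j \<in> jobs I \<Longrightarrow> 1 \<le> u * v"
    using prediction_error_bounds[OF I assms(3)] by metis
  have "1 \<le> u * v" using uv(6) False by blast
  have "cost I (run share I) \<le> (64 * (2 * (u * v)) + 16) * cost I R'"
    by (rule cost_le_proportional_share[OF I feasible_run_share[OF I] R'])
      (use uv(1,2) run_share_proportional[OF I uv(1,2,4,5)] in auto)
  \<comment> \<open>This is where 144 arises: \<open>64 * 2 + 16\<close>, with 16 absorbed by
    \<open>1 \<le> u * v\<close>.\<close>
  also have "\<dots> \<le> 144 * (u * v) * cost I R'"
    using \<open>1 \<le> u * v\<close> cost_nonneg[OF I] by (intro mult_right_mono) auto
  finally show ?thesis using uv(1-3) by simp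
qed (simp add: cost_def)

theorem theorem8:
  "\<exists>(A :: algorithm) (c :: real). 0 < c \<and>
     competitive A (\<lambda>I. ennreal c * min (prediction_error I) (of_nat (width I)))"
proof (intro exI conjI)
  show "competitive share (\<lambda>I. ennreal 144 * min (prediction_error I) (of_nat (width I)))"
    unfolding competitive_def
  proof (intro allI impI conjI)
    fix I assume I: "out_forest_inst I"
    let ?R = "run share I"
    show feasible: "feasible I ?R" by (rule feasible_run_share[OF I])
    define r where "r = min (prediction_error I) (of_nat (width I))"
    define m where "m = enn2real r"
    \<comment> \<open>The width is finite, so the comparison with each feasible schedule can be made
      in the reals.\<close>
    have "r < top" by (simp add: r_def min_less_iff_disj of_nat_less_top)
    then have m: "r = ennreal m" "0 \<le> m"
      by (simp_all add: m_def)
    have le: "cost I ?R \<le> 144 * m * cost I R'" if "feasible I R'" for R'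
    proof (cases "prediction_error I \<le> of_nat (width I)")
      case True
      then have "prediction_error I \<noteq> top"
        by (metis ennreal_of_nat_neq_top top_unique)
      with cost_run_share_le_prediction_error[OF I that] True show ?thesis
        by (simp add: m_def r_def)
    next
      case False
      then have "m = real (width I)"
        by (simp add: m_def r_def)
      with cost_run_share_le_width[OF I that] show ?thesis by simp
    qed
    have "cost I ?R \<le> 144 * m * opt I"
    \<comment> \<open>Passing to the infimum divides by \<open>m\<close>. If \<open>m = 0\<close>,
      comparing the algorithm with itself already bounds its cost by 0.\<close>
    proof (cases "m = 0")
      case True
      then show ?thesis using le[OF feasible] by simp
    next
      case False
      then have "cost I ?R / (144 * m) \<le> opt I"
        unfolding opt_def
        by (intro cINF_greatest) (use feasible le m(2) in \<open>auto simp: field_simps\<close>)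
      with False m(2) show ?thesis by (simp add: field_simps)
    qed
    then have "ennreal (cost I ?R) \<le> ennreal (144 * m * opt I)" by (rule ennreal_leI)
    also have "\<dots> = ennreal 144 * r * ennreal (opt I)"
      using m(2) by (simp add: m(1) ennreal_mult' ennreal_mult)
    finally show "ennreal (cost I ?R)
        \<le> ennreal 144 * min (prediction_error I) (of_nat (width I)) * ennreal (opt I)"
      by (simp add: r_def)
  qed
qed simp

end
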